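(* Let $\mathcal{H}$ be an infinite-dimensional separable Hilbert space over $\mathbb{K}$ and $W=\mathcal{H}\oplus\mathcal{H}^*$. The Moyal star-product and the normal star-product (i.e. the star-products $\star^A_\hbar$ of the context for $A=0$ and $A=\mathbb{I}$, respectively) are not equivalent deformations on $(W,\mathcal{F}_{HS}[[\hbar]])$.
   Context: $\mathbb{K}$ is $\mathbb{R}$ or $\mathbb{C}$. $C^\infty(W,\mathbb{K})$ is the space of $\mathbb{K}$-valued functions on $W$ that are smooth in the Fréchet sense (over $\mathbb{K}$); $D^{(r)}F(w)$ is the $r$-th Fréchet derivative. $D_1F$ and $D_2F$ are the partial derivatives along $\mathcal{H}$ and $\mathcal{H}^*$, so $D_1F(x,\eta)\in\mathcal{H}^*$ and, identifying $\mathcal{H}^{**}\simeq\mathcal{H}$, $D_2F(x,\eta)\in\mathcal{H}$. $\langle\cdot,\cdot\rangle:\mathcal{H}^*\times\mathcal{H}\to\mathbb{K}$ is the canonical pairing. The canonical Poisson bracket is $\{F,G\}=\langle D_1F,D_2G\rangle-\langle D_1G,D_2F\rangle$. Fix an orthonormal basis $\{e_i\}_{i\ge1}$ of $\mathcal{H}$ with dual basis $\{e_i^*\}_{i\ge1}$ of $\mathcal{H}^*$; $\partial_i$ is the derivative in the direction $(e_i,0)$, $\partial_{i^*}$ the derivative in the direction $(0,e_i^* )$, similarly for iterated derivatives, and $i^\sharp$ stands for either $i$ or $i^*$. $\mathcal{F}_{HS}$, the algebra of functions of Hilbert-Schmidt type, is the set of $F\in C^\infty(W,\mathbb{K})$ such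 that $\sum_{i_1,\dots,i_r\ge1}|\partial_{i_1^\sharp\cdots i_r^\sharp}F(x,\eta)|^2<\infty$ for all $r\ge1$, all $(x,\eta)\in W$ and all choices of $\sharp$'s (independent of the basis). For $F\in\mathcal{F}_{HS}$, $D^{(m)}F(w)$ is identified with an element of the $m$-th Hilbert tensor power $W^{\otimes m}$ (identifying $W^*\simeq\mathcal{H}^*\oplus\mathcal{H}$ with $W$). An $r$-differential operator on $(W,\mathcal{F}_{HS})$ is an $r$-linear map $\mathbf{A}:\mathcal{F}_{HS}^r\to\mathcal{F}_{HS}$ of the form $\mathbf{A}(F_1,\dots,F_r)(w)=\sum_{n_1,\dots,n_r\ge0}a^{(n_1,\dots,n_r)}(w).(D^{(n_1)}F_1(w),\dots,D^{(n_r)}F_r(w))$ (finitely many nonzero terms), where each $a^{(n_1,\dots,n_r)}(w)$ is a bounded $r$-linear form on $W^{\otimes n_1}\times\cdots\times W^{\otimes n_r}$ depending smoothly on $w\in W$. "Vanishing on constants" means vanishing when any argument is a constant function. For a bounded operator $A$ on $\mathcal{H}$ and $\mathbb{I}$ the identity operator on $\mathcal{H}$, let $b_A$ be the bounded bilinear form on $W^*\simeq\mathcal{H}^*\oplus\mathcal{H}$ given by $b_A((\xi,y),(\xi',y'))=\langle\xi,(A+\mathbb{I})y'\rangle+\langle\xi',(A-\mathbb{I})y\rangle$, and let $C_r^A(F,G)(w)=b_A^{\otimes r}(D^{(r)}F(w),D^{(r)}G(w))$, where $b_A^{\otimes r}$ is the bounded bilinear form on $(W^* )^{\otimes r}$ determined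 by $b_A^{\otimes r}(u_1\otimes\cdots\otimes u_r,v_1\otimes\cdots\otimes v_r)=\prod_kb_A(u_k,v_k)$. Then $F\star^A_\hbar G=FG+\sum_{r\ge1}\frac{\hbar^r}{r!}C_r^A(F,G)$ for $F,G\in\mathcal{F}_{HS}$, extended $\mathbb{K}[[\hbar]]$-bilinearly to $\mathcal{F}_{HS}[[\hbar]]$. For $A=0$, $C_1^0(F,G)=\{F,G\}$ (Moyal star-product); for $A=\mathbb{I}$, $C_1^{\mathbb{I}}(F,G)=2\langle D_1F,D_2G\rangle$ (normal star-product). Two deformation quantizations $(W,\mathcal{F}_{HS}[[\hbar]],\star^1_\hbar)$ and $(W,\mathcal{F}_{HS}[[\hbar]],\star^2_\hbar)$ are equivalent if there is a $\mathbb{K}[[\hbar]]$-linear map $T=\mathrm{Id}+\sum_{r\ge1}\hbar^rT_r$ on $\mathcal{F}_{HS}[[\hbar]]$, with each $T_r:\mathcal{F}_{HS}\to\mathcal{F}_{HS}$ a ($1$-)differential operator vanishing on constants, such that $T(F)\star^1_\hbar T(G)=T(F\star^2_\hbar G)$ for all $F,G\in\mathcal{F}_{HS}$. *)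

theory Defs
  imports "HOL-Analysis.Analysis"
begin

text \<open>
  Scalar fields that are \<open>\<real>\<close> (with trivial conjugation) or \<open>\<complex>\<close> (with complex conjugation).
\<close>

class real_or_complex = real_normed_field +
  fixes kcnj :: "'a \<Rightarrow> 'a"
  assumes real_or_complex:
    "((\<forall>z. \<exists>a. z = a *\<^sub>R 1) \<and> (\<forall>z. kcnj z = z)) \<or>
     (\<exists>j. j * j = - 1 \<and> (\<forall>z. \<exists>a b. z = a *\<^sub>R 1 + b *\<^sub>R j) \<and>
       (\<forall>a b. kcnj (a *\<^sub>R 1 + b *\<^sub>R j) = a *\<^sub>R 1 - b *\<^sub>R j))"

instantiation real :: real_or_complex
begin
definition kcnj_real :: "real \<Rightarrow> real" where "kcnj_real z = z"
instance by standard (auto simp: kcnj_real_def)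
end

instantiation complex :: real_or_complex
begin
definition kcnj_complex :: "complex \<Rightarrow> complex" where "kcnj_complex = cnj"
instance
proof
  have "z = Re z *\<^sub>R 1 + Im z *\<^sub>R \<i>" for z
    by (simp add: complex_eq_iff)
  then have "\<forall>z. \<exists>a b. z = a *\<^sub>R 1 + b *\<^sub>R \<i>" by blast
  then show "((\<forall>z::complex. \<exists>a. z = a *\<^sub>R 1) \<and> (\<forall>z::complex. kcnj z = z)) \<or>
     (\<exists>j::complex. j * j = - 1 \<and> (\<forall>z. \<exists>a b. z = a *\<^sub>R 1 + b *\<^sub>R j) \<and>
       (\<forall>a b. kcnj (a *\<^sub>R 1 + b *\<^sub>R j) = a *\<^sub>R 1 - b *\<^sub>R j))"
    by (intro disjI2 exI[of _ "\<i>"]) (simp add: kcnj_complex_def complex_eq_iff)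
qed
end


text \<open>
  A Hilbert space over \<open>'k\<close>: completeness is part of the class \<^class>\<open>banach\<close>, whose norm and
  real scalar multiplication are required to be those induced by the inner product \<open>ip\<close>
  (linear in its first argument) and the scalar multiplication \<open>sc\<close>.
\<close>

locale hilbert_space = vector_space sc
  for sc :: "'k::real_or_complex \<Rightarrow> 'h::banach \<Rightarrow> 'h" +
  fixes ip :: "'h \<Rightarrow> 'h \<Rightarrow> 'k"
  assumes sc_of_real: "sc (of_real a) x = a *\<^sub>R x"
    and ip_add: "ip (x + y) z = ip x z + ip y z"
    and ip_scale: "ip (sc c x) z = c * ip x z"
    and ip_commute: "ip y x = kcnj (ip x y)"
    and ip_norm: "ip x x = of_real ((norm x)\<^sup>2)"

text \<open>
  The type \<open>'d\<close>, with scalar multiplication \<open>sd\<close> and pairing \<open>pr\<close>, is the Banach space of all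
  bounded \<open>'k\<close>-linear functionals on \<open>'h\<close>: a dual element is given by its functional
  (injectivity of \<open>pr\<close> follows from \<open>norm_dual\<close>), and its norm is the operator norm. Keeping
  \<open>'d\<close> abstract makes \<open>'h \<times> 'd\<close> a type also when \<open>'k\<close>-linearity is stronger than
  \<open>\<real>\<close>-linearity.
\<close>

locale hilbert_dual = hilbert_space sc ip + dual: vector_space sd
  for sc :: "'k::real_or_complex \<Rightarrow> 'h::banach \<Rightarrow> 'h" and ip :: "'h \<Rightarrow> 'h \<Rightarrow> 'k"
    and sd :: "'k \<Rightarrow> 'd::banach \<Rightarrow> 'd" +
  fixes pr :: "'d \<Rightarrow> 'h \<Rightarrow> 'k"
  assumes sd_of_real: "sd (of_real a) \<xi> = a *\<^sub>R \<xi>"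
    and pr_add: "pr (\<xi> + \<xi>') x = pr \<xi> x + pr \<xi>' x"
    and pr_scale: "pr (sd c \<xi>) x = c * pr \<xi> x"
    and pr_bounded: "bounded_linear (pr \<xi>)"
    and pr_linear: "pr \<xi> (sc c x) = c * pr \<xi> x"
    and pr_surj: "bounded_linear \<phi> \<Longrightarrow> (\<And>c x. \<phi> (sc c x) = c * \<phi> x) \<Longrightarrow> \<exists>\<xi>. pr \<xi> = \<phi>"
    and norm_dual: "norm \<xi> = onorm (pr \<xi>)"


text \<open>
  Iterated Frechet derivative: \<open>nderiv F [v\<^sub>1, \<dots>, v\<^sub>m] w\<close> is \<open>D\<^sup>(\<^sup>m\<^sup>)F(w)(v\<^sub>1, \<dots>, v\<^sub>m)\<close>, i.e. the
  derivative of \<open>z \<mapsto> D\<^sup>(\<^sup>m\<^sup>-\<^sup>1\<^sup>)F(z)(v\<^sub>2, \<dots>, v\<^sub>m)\<close> at \<open>w\<close> in direction \<open>v\<^sub>1\<close>.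
\<close>

primrec nderiv :: "('w::real_normed_vector \<Rightarrow> 'k::real_normed_vector) \<Rightarrow> 'w list \<Rightarrow> 'w \<Rightarrow> 'k"
  where
    "nderiv F [] = F"
  | "nderiv F (v # vs) = (\<lambda>w. frechet_derivative (nderiv F vs) (at w) v)"


text \<open>
  The phase space \<open>W = \<H> \<oplus> \<H>\<^sup>*\<close> is the product type, whose norm is the Hilbert norm
  \<open>sqrt (norm x ^ 2 + norm \<eta> ^ 2)\<close>.
\<close>

locale phase_space = hilbert_dual sc ip sd pr
  for sc :: "'k::real_or_complex \<Rightarrow> 'h::banach \<Rightarrow> 'h" and ip :: "'h \<Rightarrow> 'h \<Rightarrow> 'k"
    and sd :: "'k \<Rightarrow> 'd::banach \<Rightarrow> 'd" and pr :: "'d \<Rightarrow> 'h \<Rightarrow> 'k" +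
  fixes e :: "nat \<Rightarrow> 'h"
  assumes e_orthonormal: "ip (e i) (e j) = of_bool (i = j)"
    and e_total: "closure (module.span sc (range e)) = UNIV"
begin

definition dual_basis :: "nat \<Rightarrow> 'd"
  where "dual_basis i = (THE \<xi>. \<forall>j. pr \<xi> (e j) = of_bool (i = j))"

text \<open>The direction \<open>i\<close> (flag \<^const>\<open>False\<close>) or \<open>i\<^sup>*\<close> (flag \<^const>\<open>True\<close>).\<close>

definition sharp :: "bool \<Rightarrow> nat \<Rightarrow> 'h \<times> 'd"
  where "sharp s i = (if s then (0, dual_basis i) else (e i, 0))"

definition scW :: "'k \<Rightarrow> 'h \<times> 'd \<Rightarrow> 'h \<times> 'd"
  where "scW c w = (sc c (fst w), sd c (snd w))"

definition multilin :: "nat \<Rightarrow> (('h \<times> 'd) list \<Rightarrow> 'k) \<Rightarrow> bool"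
  where "multilin m T \<longleftrightarrow>
    (\<forall>us vs. length us + length vs + 1 = m \<longrightarrow>
      (\<forall>u v. T (us @ (u + v) # vs) = T (us @ u # vs) + T (us @ v # vs)) \<and>
      (\<forall>c u. T (us @ scW c u # vs) = c * T (us @ u # vs)))"

definition bounded_multilin :: "nat \<Rightarrow> (('h \<times> 'd) list \<Rightarrow> 'k) \<Rightarrow> bool"
  where "bounded_multilin m T \<longleftrightarrow> multilin m T \<and>
    (\<exists>C. \<forall>vs. length vs = m \<longrightarrow> norm (T vs) \<le> C * prod_list (map norm vs))"

text \<open>
  Frechet smoothness over \<open>'k\<close> of a map \<open>a\<close> from \<open>W\<close> into the normed space of those functions
  \<open>\<phi> :: 't \<Rightarrow> 'k\<close> on \<open>S\<close> with finite norm \<open>\<parallel>\<phi>\<parallel> = inf {C. \<forall>t\<in>S. norm (\<phi> t) \<le> C * N t}\<close>. The three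
  conditions say, for every \<open>m\<close> and \<open>w\<close>, that \<open>D\<^sup>(\<^sup>m\<^sup>)a(w)\<close> is \<open>m\<close>-linear, that it is bounded, and
  that \<open>D\<^sup>(\<^sup>m\<^sup>+\<^sup>1\<^sup>)a(w)\<close> is the Frechet derivative of \<open>D\<^sup>(\<^sup>m\<^sup>)a\<close> at \<open>w\<close> with respect to the norm of
  bounded \<open>m\<close>-linear maps.
\<close>

definition smooth_into :: "'t set \<Rightarrow> ('t \<Rightarrow> real) \<Rightarrow> ('h \<times> 'd \<Rightarrow> 't \<Rightarrow> 'k) \<Rightarrow> bool"
  where "smooth_into S N a \<longleftrightarrow> (\<forall>m w.
    (\<forall>t\<in>S. multilin m (\<lambda>vs. nderiv (\<lambda>z. a z t) vs w)) \<and>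
    (\<exists>C. \<forall>vs. length vs = m \<longrightarrow> (\<forall>t\<in>S.
      norm (nderiv (\<lambda>z. a z t) vs w) \<le> C * prod_list (map norm vs) * N t)) \<and>
    (\<forall>\<epsilon>>0. \<exists>\<delta>>0. \<forall>h. norm h < \<delta> \<longrightarrow> (\<forall>vs. length vs = m \<longrightarrow> (\<forall>t\<in>S.
      norm (nderiv (\<lambda>z. a z t) vs (w + h) - nderiv (\<lambda>z. a z t) vs w
            - nderiv (\<lambda>z. a z t) (h # vs) w)
        \<le> \<epsilon> * norm h * prod_list (map norm vs) * N t))))"

definition smooth_fun :: "('h \<times> 'd \<Rightarrow> 'k) \<Rightarrow> bool"
  where "smooth_fun F \<longleftrightarrow> smooth_into (UNIV :: unit set) (\<lambda>_. 1) (\<lambda>w _. F w)"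

definition F_HS :: "('h \<times> 'd \<Rightarrow> 'k) set"
  where "F_HS = {F. smooth_fun F \<and>
    (\<forall>r\<ge>1. \<forall>w. \<forall>ss. length ss = r \<longrightarrow>
      (\<lambda>is. (norm (nderiv F (map2 sharp ss is) w))\<^sup>2) summable_on {is. length is = r})}"

text \<open>
  The \<open>m\<close>-th Hilbert tensor power is modelled by the Hilbert--Schmidt \<open>m\<close>-linear forms on \<open>W\<close>,
  written as functions on lists that vanish on lists of length other than \<open>m\<close>.
\<close>

definition hs_forms :: "nat \<Rightarrow> (('h \<times> 'd) list \<Rightarrow> 'k) set"
  where "hs_forms m = {T. bounded_multilin m T \<and> (\<forall>vs. length vs \<noteq> m \<longrightarrow> T vs = 0) \<and>
    (\<lambda>ix. (norm (T (map (\<lambda>(s, i). sharp s i) ix)))\<^sup>2) summable_on {ix. length ix = m}}"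

definition hs_norm :: "nat \<Rightarrow> (('h \<times> 'd) list \<Rightarrow> 'k) \<Rightarrow> real"
  where "hs_norm m T =
    sqrt (\<Sum>\<^sub>\<infinity>ix\<in>{ix. length ix = m}. (norm (T (map (\<lambda>(s, i). sharp s i) ix)))\<^sup>2)"

definition D :: "nat \<Rightarrow> ('h \<times> 'd \<Rightarrow> 'k) \<Rightarrow> 'h \<times> 'd \<Rightarrow> ('h \<times> 'd) list \<Rightarrow> 'k"
  where "D m F w = (\<lambda>vs. if length vs = m then nderiv F vs w else 0)"

definition bounded_form :: "nat \<Rightarrow> ((('h \<times> 'd) list \<Rightarrow> 'k) \<Rightarrow> 'k) \<Rightarrow> bool"
  where "bounded_form m \<phi> \<longleftrightarrow>
    (\<forall>S\<in>hs_forms m. \<forall>T\<in>hs_forms m. \<phi> (\<lambda>vs. S vs + T vs) = \<phi> S + \<phi> T) \<and>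
    (\<forall>c. \<forall>T\<in>hs_forms m. \<phi> (\<lambda>vs. c * T vs) = c * \<phi> T) \<and>
    (\<exists>C. \<forall>T\<in>hs_forms m. norm (\<phi> T) \<le> C * hs_norm m T)"

definition bounded_bilinear_form ::
    "nat \<Rightarrow> ((('h \<times> 'd) list \<Rightarrow> 'k) \<Rightarrow> (('h \<times> 'd) list \<Rightarrow> 'k) \<Rightarrow> 'k) \<Rightarrow> bool"
  where "bounded_bilinear_form m B \<longleftrightarrow>
    (\<forall>S\<in>hs_forms m. bounded_form m (B S)) \<and>
    (\<forall>T\<in>hs_forms m. bounded_form m (\<lambda>S. B S T)) \<and>
    (\<exists>C. \<forall>S\<in>hs_forms m. \<forall>T\<in>hs_forms m. norm (B S T) \<le> C * hs_norm m S * hs_norm m T)"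

definition differential_operator :: "(('h \<times> 'd \<Rightarrow> 'k) \<Rightarrow> ('h \<times> 'd \<Rightarrow> 'k)) \<Rightarrow> bool"
  where "differential_operator P \<longleftrightarrow> P ` F_HS \<subseteq> F_HS \<and>
    (\<exists>M a. (\<forall>n\<le>M. (\<forall>w. bounded_form n (a n w)) \<and> smooth_into (hs_forms n) (hs_norm n) (a n)) \<and>
      (\<forall>F\<in>F_HS. \<forall>w. P F w = (\<Sum>n\<le>M. a n w (D n F w))))"

definition vanishes_on_constants :: "(('h \<times> 'd \<Rightarrow> 'k) \<Rightarrow> ('h \<times> 'd \<Rightarrow> 'k)) \<Rightarrow> bool"
  where "vanishes_on_constants P \<longleftrightarrow> (\<forall>c. P (\<lambda>_. c) = (\<lambda>_. 0))"

text \<open>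
  An element \<open>(\<xi>, y)\<close> of \<open>W\<^sup>* = \<H>\<^sup>* \<oplus> \<H>\<close> acts on \<open>W\<close> by \<open>(x, \<eta>) \<mapsto> \<langle>\<xi>, x\<rangle> + \<langle>\<eta>, y\<rangle>\<close>; the elementary
  tensor \<open>u\<^sub>1 \<otimes> \<dots> \<otimes> u\<^sub>r\<close> is the product form.
\<close>

definition covector :: "'d \<times> 'h \<Rightarrow> 'h \<times> 'd \<Rightarrow> 'k"
  where "covector u w = pr (fst u) (fst w) + pr (snd w) (snd u)"

definition elem_tensor :: "('d \<times> 'h) list \<Rightarrow> ('h \<times> 'd) list \<Rightarrow> 'k"
  where "elem_tensor us =
    (\<lambda>vs. if length vs = length us then prod_list (map2 covector us vs) else 0)"

definition b_form :: "('h \<Rightarrow> 'h) \<Rightarrow> 'd \<times> 'h \<Rightarrow> 'd \<times> 'h \<Rightarrow> 'k"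
  where "b_form A = (\<lambda>(\<xi>, y) (\<xi>', y'). pr \<xi> (A y' + y') + pr \<xi>' (A y - y))"

text \<open>
  For bounded \<open>A\<close> the form \<open>b\<^sub>A\<^sup>\<otimes>\<^sup>r\<close> exists and is unique on \<^const>\<open>hs_forms\<close>, since finite sums of
  elementary tensors are dense there.
\<close>

definition b_tensor ::
    "('h \<Rightarrow> 'h) \<Rightarrow> nat \<Rightarrow> (('h \<times> 'd) list \<Rightarrow> 'k) \<Rightarrow> (('h \<times> 'd) list \<Rightarrow> 'k) \<Rightarrow> 'k"
  where "b_tensor A r = (SOME B. bounded_bilinear_form r B \<and>
    (\<forall>us vs. length us = r \<longrightarrow> length vs = r \<longrightarrow>
      B (elem_tensor us) (elem_tensor vs) = prod_list (map2 (b_form A) us vs)))"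

definition C_op :: "('h \<Rightarrow> 'h) \<Rightarrow> nat \<Rightarrow> ('h \<times> 'd \<Rightarrow> 'k) \<Rightarrow> ('h \<times> 'd \<Rightarrow> 'k) \<Rightarrow> 'h \<times> 'd \<Rightarrow> 'k"
  where "C_op A r F G w = b_tensor A r (D r F w) (D r G w)"

definition star_coeff ::
    "('h \<Rightarrow> 'h) \<Rightarrow> nat \<Rightarrow> ('h \<times> 'd \<Rightarrow> 'k) \<Rightarrow> ('h \<times> 'd \<Rightarrow> 'k) \<Rightarrow> 'h \<times> 'd \<Rightarrow> 'k"
  where "star_coeff A r F G w = (if r = 0 then F w * G w else C_op A r F G w / fact r)"

text \<open>
  Formal power series with coefficients in a function space are elements of
  \<^typ>\<open>('h \<times> 'd \<Rightarrow> 'k) fps\<close>; \<open>star A\<close> is the \<open>\<hbar>\<close>-bilinear extension of \<open>\<Sum>\<^sub>r \<hbar>\<^sup>r star_coeff A r\<close>.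
\<close>

definition star ::
    "('h \<Rightarrow> 'h) \<Rightarrow> ('h \<times> 'd \<Rightarrow> 'k) fps \<Rightarrow> ('h \<times> 'd \<Rightarrow> 'k) fps \<Rightarrow> ('h \<times> 'd \<Rightarrow> 'k) fps"
  where "star A f g = Abs_fps (\<lambda>n w.
    \<Sum>i\<le>n. \<Sum>j\<le>n - i. star_coeff A (n - i - j) (fps_nth f i) (fps_nth g j) w)"

definition embed :: "('h \<times> 'd \<Rightarrow> 'k) \<Rightarrow> ('h \<times> 'd \<Rightarrow> 'k) fps"
  where "embed F = Abs_fps (\<lambda>n. if n = 0 then F else (\<lambda>_. 0))"

text \<open>The formal series of operators \<open>Id + \<Sum>\<^sub>r\<^sub>\<ge>\<^sub>1 \<hbar>\<^sup>r P\<^sub>r\<close>; the value of \<open>P 0\<close> is irrelevant.\<close>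

definition formal_op ::
    "(nat \<Rightarrow> ('h \<times> 'd \<Rightarrow> 'k) \<Rightarrow> ('h \<times> 'd \<Rightarrow> 'k)) \<Rightarrow> ('h \<times> 'd \<Rightarrow> 'k) fps \<Rightarrow> ('h \<times> 'd \<Rightarrow> 'k) fps"
  where "formal_op P f = Abs_fps (\<lambda>n w. fps_nth f n w + (\<Sum>r=1..n. P r (fps_nth f (n - r)) w))"

definition equivalent ::
    "(('h \<times> 'd \<Rightarrow> 'k) fps \<Rightarrow> ('h \<times> 'd \<Rightarrow> 'k) fps \<Rightarrow> ('h \<times> 'd \<Rightarrow> 'k) fps) \<Rightarrow>
     (('h \<times> 'd \<Rightarrow> 'k) fps \<Rightarrow> ('h \<times> 'd \<Rightarrow> 'k) fps \<Rightarrow> ('h \<times> 'd \<Rightarrow> 'k) fps) \<Rightarrow> bool"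
  where "equivalent star1 star2 \<longleftrightarrow>
    (\<exists>P. (\<forall>r\<ge>1. differential_operator (P r) \<and> vanishes_on_constants (P r)) \<and>
      (\<forall>F\<in>F_HS. \<forall>G\<in>F_HS.
        star1 (formal_op P (embed F)) (formal_op P (embed G)) =
        formal_op P (star2 (embed F) (embed G))))"

end

end

theory Submission
  imports Defs
begin

text \<open>
  At order \<open>\<hbar>\<close> an equivalence forces
  \<open>P\<^sub>1(FG) - P\<^sub>1(F) G - F P\<^sub>1(G) = - (\<langle>D\<^sub>1F, D\<^sub>2G\<rangle> + \<langle>D\<^sub>1G, D\<^sub>2F\<rangle>)\<close>. With the coordinate functions
  \<open>F = x\<^sub>i\<close> and \<open>G = \<eta>\<^sub>i\<close> this reads \<open>P\<^sub>1(x\<^sub>i \<eta>\<^sub>i)(0) = -1\<close>, so the second order coefficient of \<open>P\<^sub>1\<close> at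
  \<open>0\<close> acts as minus a trace. But a bounded form on Hilbert--Schmidt tensors cannot do so: the
  tensors of \<open>x\<^sub>i \<eta>\<^sub>i\<close>, summed over \<open>i < N\<close>, have Hilbert--Schmidt norm \<open>sqrt (2 N)\<close>, while the
  form takes the value \<open>-N\<close> on them.
\<close>

section \<open>Scalars: conjugation, norm and completeness\<close>

lemma kcnj_zero [simp]: "kcnj (0::'k::real_or_complex) = 0"
  using real_or_complex[where 'a='k]
proof
  assume "\<exists>j::'k. j * j = - 1 \<and> (\<forall>z. \<exists>a b. z = a *\<^sub>R 1 + b *\<^sub>R j) \<and>
       (\<forall>a b. kcnj (a *\<^sub>R 1 + b *\<^sub>R j) = a *\<^sub>R 1 - b *\<^sub>R j)"
  then obtain j :: 'k where "\<And>a b. kcnj (a *\<^sub>R 1 + b *\<^sub>R j) = a *\<^sub>R 1 - b *\<^sub>R j" by blast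
  from this[of 0 0] show ?thesis by simp
qed simp

text \<open>The norm of \<open>'k\<close> is only assumed multiplicative, so it is compared with
  \<open>z * kcnj z\<close> through the triangle inequality for \<open>z = a + b j\<close>; this
  costs the factor 2, which is harmless for boundedness.\<close>

lemma mult_kcnj_of_real:
  fixes z :: "'k::real_or_complex"
  obtains r where "z * kcnj z = of_real r" "(norm z)\<^sup>2 \<le> 2 * r"
  using real_or_complex[where 'a='k]
proof
  assume *: "(\<forall>z::'k. \<exists>a. z = a *\<^sub>R 1) \<and> (\<forall>z::'k. kcnj z = z)"
  then obtain a where "z = a *\<^sub>R 1" by blast
  with * have "z * kcnj z = of_real (a\<^sup>2)" "(norm z)\<^sup>2 \<le> 2 * a\<^sup>2"
    by (simp_all add: power2_eq_square of_real_def)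
  with that show ?thesis by blast
next
  assume "\<exists>j::'k. j * j = - 1 \<and> (\<forall>z. \<exists>a b. z = a *\<^sub>R 1 + b *\<^sub>R j) \<and>
       (\<forall>a b. kcnj (a *\<^sub>R 1 + b *\<^sub>R j) = a *\<^sub>R 1 - b *\<^sub>R j)"
  then obtain j :: 'k and a b where j: "j * j = - 1" and z: "z = a *\<^sub>R 1 + b *\<^sub>R j"
    and cz: "kcnj z = a *\<^sub>R 1 - b *\<^sub>R j" by metis
  have "norm j * norm j = 1" by (metis j norm_minus_cancel norm_mult norm_one)
  then have nj: "norm j = 1" by (metis abs_norm_cancel abs_square_eq_1 power2_eq_square)
  have "z * kcnj z = (a * a) *\<^sub>R 1 - (b * b) *\<^sub>R (j * j)"
    unfolding cz unfolding z by (simp add: algebra_simps)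
  also have "\<dots> = of_real (a\<^sup>2 + b\<^sup>2)"
    by (simp add: j of_real_def power2_eq_square algebra_simps)
  finally have 1: "z * kcnj z = of_real (a\<^sup>2 + b\<^sup>2)" .
  have "norm z \<le> \<bar>a\<bar> + \<bar>b\<bar>"
    unfolding z by (rule order_trans[OF norm_triangle_ineq]) (simp add: nj)
  then have "(norm z)\<^sup>2 \<le> (\<bar>a\<bar> + \<bar>b\<bar>)\<^sup>2" by (simp add: power_mono)
  also have "\<dots> \<le> 2 * (a\<^sup>2 + b\<^sup>2)"
    using sum_squares_bound[of "\<bar>a\<bar>" "\<bar>b\<bar>"] by (simp add: power2_sum)
  finally show ?thesis using 1 that by blast
qed

text \<open>Completeness makes absolutely summable families of scalars summable, on which the
  additivity of the trace forms rests.\<close>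

instance real_or_complex \<subseteq> banach
proof
  fix X :: "nat \<Rightarrow> 'a" assume X: "Cauchy X"
  from real_or_complex[where 'a='a] show "convergent X"
  proof
    assume "(\<forall>z::'a. \<exists>a. z = a *\<^sub>R 1) \<and> (\<forall>z::'a. kcnj z = z)"
    then have "\<forall>n. \<exists>a. X n = a *\<^sub>R 1" by blast
    then obtain a where a: "\<And>n. X n = a n *\<^sub>R 1" by metis
    with X have "Cauchy a"
      by (simp add: Cauchy_def dist_norm flip: scaleR_diff_left)
    then obtain l where "a \<longlonglongrightarrow> l" by (auto simp: Cauchy_convergent_iff convergent_def)
    then have "(\<lambda>n. a n *\<^sub>R 1) \<longlonglongrightarrow> l *\<^sub>R (1::'a)" by (intro tendsto_intros)
    then show ?thesis by (auto simp: convergent_def simp flip: a)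
  next
    assume "\<exists>j::'a. j * j = - 1 \<and> (\<forall>z. \<exists>a b. z = a *\<^sub>R 1 + b *\<^sub>R j) \<and>
       (\<forall>a b. kcnj (a *\<^sub>R 1 + b *\<^sub>R j) = a *\<^sub>R 1 - b *\<^sub>R j)"
    then obtain j :: 'a where j: "j * j = - 1" and "\<forall>n. \<exists>a b. X n = a *\<^sub>R 1 + b *\<^sub>R j" by metis
    then obtain a b where ab: "\<And>n. X n = a n *\<^sub>R 1 + b n *\<^sub>R j" by metis
    have "norm j * norm j = 1" by (metis j norm_minus_cancel norm_mult norm_one)
    then have nj: "norm j = 1" by (metis abs_norm_cancel abs_square_eq_1 power2_eq_square)
    \<comment> \<open>The norm of the field is only assumed multiplicative; bounding the conjugate from above
      in \<open>(a + b j) (a - b j) = a\<^sup>2 + b\<^sup>2\<close> bounds \<open>a + b j\<close> from below.\<close>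
    have le: "\<bar>a\<bar> + \<bar>b\<bar> \<le> 2 * norm (a *\<^sub>R 1 + b *\<^sub>R j)" for a b
    proof -
      let ?z = "a *\<^sub>R 1 + b *\<^sub>R j" and ?w = "a *\<^sub>R 1 - b *\<^sub>R j"
      have "?z * ?w = of_real (a\<^sup>2 + b\<^sup>2)"
        by (simp add: algebra_simps j of_real_def power2_eq_square)
      then have "norm ?z * norm ?w = a\<^sup>2 + b\<^sup>2"
        by (metis abs_of_nonneg norm_mult norm_of_real sum_power2_ge_zero)
      moreover have "norm ?w \<le> \<bar>a\<bar> + \<bar>b\<bar>"
        by (rule order_trans[OF norm_triangle_ineq4]) (simp add: nj)
      then have "norm ?z * norm ?w \<le> norm ?z * (\<bar>a\<bar> + \<bar>b\<bar>)" by (simp add: mult_left_mono)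
      ultimately have "a\<^sup>2 + b\<^sup>2 \<le> norm ?z * (\<bar>a\<bar> + \<bar>b\<bar>)" by simp
      moreover have "(\<bar>a\<bar> + \<bar>b\<bar>) * (\<bar>a\<bar> + \<bar>b\<bar>) \<le> 2 * (a\<^sup>2 + b\<^sup>2)"
        using sum_squares_bound[of "\<bar>a\<bar>" "\<bar>b\<bar>"] by (simp add: algebra_simps power2_eq_square)
      ultimately have "(\<bar>a\<bar> + \<bar>b\<bar>) * (\<bar>a\<bar> + \<bar>b\<bar>) \<le> (2 * norm ?z) * (\<bar>a\<bar> + \<bar>b\<bar>)" by simp
      then have "\<bar>a\<bar> + \<bar>b\<bar> \<le> 2 * norm ?z" if "\<bar>a\<bar> + \<bar>b\<bar> > 0"
        using that by (rule mult_right_le_imp_le)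
      then show ?thesis using norm_ge_zero[of ?z] by linarith
    qed
    have diff: "\<bar>a m - a n\<bar> + \<bar>b m - b n\<bar> \<le> 2 * dist (X m) (X n)" for m n
      using le[of "a m - a n" "b m - b n"] by (simp add: ab dist_norm algebra_simps)
    have "Cauchy c" if "\<And>m n. dist (c m) (c n) \<le> 2 * dist (X m) (X n)" for c :: "nat \<Rightarrow> real"
      unfolding Cauchy_def
    proof (intro allI impI)
      fix \<epsilon> :: real assume "\<epsilon> > 0"
      with X obtain M where "\<And>m n. m \<ge> M \<Longrightarrow> n \<ge> M \<Longrightarrow> dist (X m) (X n) < \<epsilon> / 2"
        unfolding Cauchy_def by (meson half_gt_zero)
      then show "\<exists>M. \<forall>m\<ge>M. \<forall>n\<ge>M. dist (c m) (c n) < \<epsilon>"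
        using that by (intro exI[of _ M]) (smt (verit) field_sum_of_halves)
    qed
    then have "Cauchy a" "Cauchy b"
      using diff by (simp_all add: dist_real_def) (smt (verit))+
    then have "convergent a" "convergent b" by (simp_all add: Cauchy_convergent)
    then obtain l m where "a \<longlonglongrightarrow> l" "b \<longlonglongrightarrow> m" by (auto simp: convergent_def)
    then have "(\<lambda>n. a n *\<^sub>R 1 + b n *\<^sub>R j) \<longlonglongrightarrow> l *\<^sub>R 1 + m *\<^sub>R j"
      by (intro tendsto_intros)
    then show ?thesis by (auto simp: convergent_def simp flip: ab)
  qed
qed

text \<open>Lists of directions are split this way because the derivatives of a quadratic function
  have a shape of their own at the orders 0, 1 and 2 and vanish from order 3 on.\<close>

lemma list_length_cases:
  obtains "vs = []" | v where "vs = [v]" | u v where "vs = [u, v]" | "length vs \<ge> 3"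
proof -
  have "length vs = 0 \<or> length vs = Suc 0 \<or> length vs = Suc (Suc 0) \<or> length vs \<ge> 3" by linarith
  then show thesis using that by (auto simp only: length_Suc_conv length_0_conv)
qed

text \<open>The finite Cauchy-Schwarz inequality bounds all finite partial sums of the norms by the
  same constant, which gives both absolute summability and the estimate.\<close>

lemma infsum_Cauchy_Schwarz:
  fixes f g :: "'a \<Rightarrow> 'b::{real_normed_field, banach}"
  assumes f: "(\<lambda>i. (norm (f i))\<^sup>2) summable_on A" and g: "(\<lambda>i. (norm (g i))\<^sup>2) summable_on A"
  shows "(\<lambda>i. f i * g i) abs_summable_on A"
    and "norm (\<Sum>\<^sub>\<infinity>i\<in>A. f i * g i)
      \<le> sqrt (\<Sum>\<^sub>\<infinity>i\<in>A. (norm (f i))\<^sup>2) * sqrt (\<Sum>\<^sub>\<infinity>i\<in>A. (norm (g i))\<^sup>2)" (is "_ \<le> ?R")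
proof -
  have fin: "(\<Sum>i\<in>X. norm (f i * g i)) \<le> ?R" if X: "finite X" "X \<subseteq> A" for X
  proof -
    have "(\<Sum>i\<in>X. norm (f i * g i)) \<le> L2_set (\<lambda>i. norm (f i)) X * L2_set (\<lambda>i. norm (g i)) X"
      using L2_set_mult_ineq[of "\<lambda>i. norm (f i)" "\<lambda>i. norm (g i)" X] by (simp add: norm_mult)
    also have "\<dots> \<le> ?R"
      unfolding L2_set_def
      by (intro mult_mono real_sqrt_le_mono finite_sum_le_infsum f g X)
        (auto intro: infsum_nonneg sum_nonneg)
    finally show ?thesis .
  qed
  show *: "(\<lambda>i. f i * g i) abs_summable_on A"
    by (rule nonneg_bdd_above_summable_on) (use fin in \<open>auto intro!: bdd_aboveI2\<close>)
  have "norm (\<Sum>\<^sub>\<infinity>i\<in>A. f i * g i) \<le> (\<Sum>\<^sub>\<infinity>i\<in>A. norm (f i * g i))"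
    by (rule norm_infsum_bound[OF *])
  also have "\<dots> \<le> ?R" by (rule infsum_le_finite_sums[OF * fin])
  finally show "norm (\<Sum>\<^sub>\<infinity>i\<in>A. f i * g i) \<le> ?R" .
qed

section \<open>Orthogonality in the Hilbert space\<close>

context hilbert_space
begin

lemma ip_zero [simp]: "ip 0 y = 0"
  using ip_scale[of 0 0 y] by simp

lemma ip_diff: "ip (x - y) z = ip x z - ip y z"
  using ip_add[of "x - y" y z] by (simp add: algebra_simps)

lemma ip_sum: "ip (sum f X) z = (\<Sum>i\<in>X. ip (f i) z)"
  by (induction X rule: infinite_finite_induct) (auto simp: ip_add)

lemma ip_eq_zero_commute: "ip x y = 0 \<Longrightarrow> ip y x = 0"
  using ip_commute[of y x] by simp

lemma norm_add_orthogonal: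
  assumes "ip x y = 0"
  shows "(norm (x + y))\<^sup>2 = (norm x)\<^sup>2 + (norm y)\<^sup>2"
proof -
  \<comment> \<open>Additivity in the second argument has to pass through \<open>ip_commute\<close>;
    if one of the two terms vanishes, this can be done without splitting \<open>kcnj\<close> of a
    sum.\<close>
  have r: "ip z (x + y) = ip z x + ip z y" if "ip z x = 0 \<or> ip z y = 0" for z
    using that
  proof
    have k: "ip z (x + y) = kcnj (ip x z + ip y z)" by (metis ip_add ip_commute)
    show ?thesis if "ip z x = 0" using that k ip_eq_zero_commute[OF that] ip_commute[of z y]
      by (metis add_0)
    show ?thesis if "ip z y = 0" using that k ip_eq_zero_commute[OF that] ip_commute[of z x]
      by (metis add.right_neutral)
  qed
  have "(of_real ((norm (x + y))\<^sup>2) :: 'k) = of_real ((norm x)\<^sup>2 + (norm y)\<^sup>2)"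
    unfolding of_real_add ip_norm[symmetric]
    using assms ip_eq_zero_commute[OF assms] by (simp add: ip_add r)
  then show ?thesis by (simp only: of_real_eq_iff)
qed

end

section \<open>The dual basis and expansions in the orthonormal basis\<close>

context phase_space
begin

text \<open>Pythagoras for the projection of \<open>x\<close> onto the line of \<open>e i\<close>
  and its remainder; \<open>sqrt 2\<close> is the loss from
  \<open>mult_kcnj_of_real\<close>.\<close>

lemma norm_ip_basis_le: "norm (ip x (e i)) \<le> sqrt 2 * norm x"
proof -
  let ?c = "ip x (e i)"
  obtain r where r: "?c * kcnj ?c = of_real r" "(norm ?c)\<^sup>2 \<le> 2 * r"
    by (rule mult_kcnj_of_real)
  have "ip (x - sc ?c (e i)) (sc ?c (e i)) = 0"
    by (rule ip_eq_zero_commute, subst ip_scale, subst ip_eq_zero_commute[of _ "e i"])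
      (simp_all add: ip_diff ip_scale e_orthonormal)
  from norm_add_orthogonal[OF this]
  have "(norm (sc ?c (e i)))\<^sup>2 \<le> (norm x)\<^sup>2" by simp
  moreover have "of_real ((norm (sc ?c (e i)))\<^sup>2) = (of_real r :: 'k)"
    unfolding ip_norm[symmetric] ip_scale ip_commute[where y = "e i" and x = "sc ?c (e i)"]
    by (simp add: e_orthonormal r(1))
  ultimately have "r \<le> (norm x)\<^sup>2" by (simp only: of_real_eq_iff)
  with r(2) have "(norm ?c)\<^sup>2 \<le> 2 * (norm x)\<^sup>2" by simp
  then have "sqrt ((norm ?c)\<^sup>2) \<le> sqrt (2 * (norm x)\<^sup>2)" by (rule real_sqrt_le_mono)
  then show ?thesis by (simp add: real_sqrt_mult)
qed

lemma bounded_linear_ip_basis: "bounded_linear (\<lambda>x. ip x (e i))"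
proof (rule bounded_linear_intro)
  show "ip (r *\<^sub>R x) (e i) = r *\<^sub>R ip x (e i)" for r x
    by (simp add: ip_scale scaleR_conv_of_real flip: sc_of_real)
  show "norm (ip x (e i)) \<le> norm x * sqrt 2" for x
    using norm_ip_basis_le[of x i] by (simp add: mult.commute)
qed (rule ip_add)

lemma pr_diff: "pr (\<xi> - \<xi>') x = pr \<xi> x - pr \<xi>' x"
  using pr_add[of "\<xi> - \<xi>'" \<xi>' x] by (simp add: algebra_simps)

text \<open>The difference vanishes on the span of the basis, hence by density and continuity
  everywhere, and so has operator norm 0.\<close>

lemma pr_eqI:
  assumes "\<And>j. pr \<xi> (e j) = pr \<xi>' (e j)"
  shows "\<xi> = \<xi>'"
proof -
  interpret d: bounded_linear "pr (\<xi> - \<xi>')" by (rule pr_bounded)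
  have e: "pr (\<xi> - \<xi>') (e j) = 0" for j by (simp add: pr_diff assms)
  have "pr (\<xi> - \<xi>') x = 0" if "x \<in> span (range e)" for x
    using that
    by (induction rule: span_induct_alt) (auto simp: d.zero d.add pr_linear e)
  then have "closure (span (range e)) \<subseteq> {x. pr (\<xi> - \<xi>') x = 0}"
    by (intro closure_minimal closed_Collect_eq continuous_intros)
      (auto intro: d.continuous_on continuous_on_id)
  then have "pr (\<xi> - \<xi>') = (\<lambda>x. 0)" using e_total by auto
  then have "norm (\<xi> - \<xi>') = 0" by (simp add: norm_dual onorm_zero)
  then show ?thesis by simp
qed

text \<open>Shows that the \<open>THE\<close> in \<open>dual_basis\<close> is well defined:
  existence comes from \<open>pr_surj\<close>, uniqueness from \<open>pr_eqI\<close>.\<close>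

lemma pr_dual_basis: "pr (dual_basis i) x = ip x (e i)"
proof -
  obtain \<xi> where \<xi>: "pr \<xi> = (\<lambda>x. ip x (e i))"
    using pr_surj[OF bounded_linear_ip_basis[of i]] by (auto simp: ip_scale)
  have "dual_basis i = \<xi>"
    unfolding dual_basis_def
    by (rule the_equality) (auto simp: \<xi> e_orthonormal intro!: pr_eqI)
  with \<xi> show ?thesis by simp
qed

lemma basis_expansion: "((\<lambda>i. sc (ip y (e i)) (e i)) has_sum y) UNIV"
  unfolding has_sum_def tendsto_iff eventually_finite_subsets_at_top
proof (intro allI impI)
  fix \<epsilon> :: real assume "\<epsilon> > 0"
  have "y \<in> closure (span (range e))" using e_total by simp
  with \<open>\<epsilon> > 0\<close> obtain z where z: "z \<in> span (range e)" "dist z y < \<epsilon>"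
    by (meson closure_approachable)
  have "\<exists>X. finite X \<and> z \<in> span (e ` X)" using z(1)
  proof (induction rule: span_induct_alt)
    case base
    then show ?case by (intro exI[of _ "{}"]) simp
  next
    case (step c x z)
    then obtain i X where "x = e i" "finite X" "z \<in> span (e ` X)" by auto
    then show ?case
      by (intro exI[of _ "insert i X"])
        (auto intro!: span_add span_scale intro: span_base span_mono[THEN subsetD, rotated])
  qed
  then obtain X where X: "finite X" "z \<in> span (e ` X)" by blast
  show "\<exists>X. finite X \<and> X \<subseteq> UNIV \<and> (\<forall>Y. finite Y \<and> X \<subseteq> Y \<and> Y \<subseteq> UNIV \<longrightarrow>
          dist (\<Sum>i\<in>Y. sc (ip y (e i)) (e i)) y < \<epsilon>)"
  proof (intro exI[of _ X] conjI allI impI X(1) subset_UNIV)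
    fix Y assume Y: "finite Y \<and> X \<subseteq> Y \<and> Y \<subseteq> UNIV"
    define p where "p = (\<Sum>i\<in>Y. sc (ip y (e i)) (e i))"
    have e: "ip (e j) (y - p) = 0" if "j \<in> Y" for j
    proof (rule ip_eq_zero_commute)
      have "ip p (e j) = (\<Sum>i\<in>Y. if i = j then ip y (e j) else 0)"
        unfolding p_def ip_sum by (intro sum.cong) (auto simp: ip_scale e_orthonormal)
      with Y that show "ip (y - p) (e j) = 0" by (simp add: ip_diff)
    qed
    have orth: "ip v (y - p) = 0" if "v \<in> span (e ` Y)" for v
      using that by (induction rule: span_induct_alt) (auto simp: ip_add ip_scale e)
    have "z \<in> span (e ` Y)" using X(2) Y span_mono[of "e ` X" "e ` Y"] by blast
    moreover have "p \<in> span (e ` Y)"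
      unfolding p_def by (intro span_sum span_scale span_base) auto
    ultimately have "ip (p - z) (y - p) = 0" by (intro orth span_diff)
    \<comment> \<open>\<open>y - z\<close> is the orthogonal sum of \<open>p - z\<close> and
      \<open>y - p\<close>.\<close>
    from norm_add_orthogonal[OF this] have "(norm (y - p))\<^sup>2 \<le> (norm (y - z))\<^sup>2"
      by (simp add: algebra_simps)
    then have "norm (y - p) \<le> norm (y - z)" by (simp add: power2_le_iff_abs_le)
    with z(2) show "dist (\<Sum>i\<in>Y. sc (ip y (e i)) (e i)) y < \<epsilon>"
      unfolding p_def[symmetric] by (simp add: dist_norm norm_minus_commute)
  qed
qed

text \<open>Evaluates the infinite sums that \<open>trace_form\<close> produces on elementary
  tensors.\<close>

lemma pr_expansion: "((\<lambda>i. pr \<xi> (e i) * pr (dual_basis i) y) has_sum pr \<xi> y) UNIV"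
  using has_sum_bounded_linear[OF pr_bounded basis_expansion, of \<xi> y]
  by (simp add: pr_linear pr_dual_basis o_def mult.commute)

section \<open>Forms on Hilbert-Schmidt tensors and the first order of the star-products\<close>

lemma zero_in_hs_forms: "(\<lambda>_. 0) \<in> hs_forms m"
  by (auto simp: hs_forms_def bounded_multilin_def multilin_def intro!: exI[of _ 0])

lemma bounded_form_zero:
  assumes "bounded_form m \<phi>"
  shows "\<phi> (\<lambda>_. 0) = 0"
proof -
  have "\<forall>T\<in>hs_forms m. \<phi> (\<lambda>vs. 0 * T vs) = 0 * \<phi> T"
    using assms unfolding bounded_form_def by blast
  from bspec[OF this zero_in_hs_forms] show ?thesis by simp
qed

text \<open>For \<open>m = 1\<close> the Hilbert-Schmidt sum runs over one-element lists of pairs;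
  fixing the flag \<open>s\<close> selects a subfamily of nonnegative terms.\<close>

lemma hs_form_sharp_summable:
  assumes "T \<in> hs_forms 1"
  shows "(\<lambda>i. (norm (T [sharp s i]))\<^sup>2) summable_on UNIV"
    and "sqrt (\<Sum>\<^sub>\<infinity>i. (norm (T [sharp s i]))\<^sup>2) \<le> hs_norm 1 T"
proof -
  let ?f = "\<lambda>ix. (norm (T (map (\<lambda>(s, i). sharp s i) ix)))\<^sup>2"
  have s: "?f summable_on {ix. length ix = 1}"
    using assms by (simp add: hs_forms_def)
  have sub: "range (\<lambda>i. [(s, i)]) \<subseteq> {ix. length ix = 1}" by auto
  have inj: "inj (\<lambda>i::nat. [(s, i)])" by (auto simp: inj_on_def)
  have s': "?f summable_on range (\<lambda>i. [(s, i)])" by (rule summable_on_subset_banach[OF s sub])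
  from s' show "(\<lambda>i. (norm (T [sharp s i]))\<^sup>2) summable_on UNIV"
    by (subst (asm) summable_on_reindex[OF inj]) (simp add: o_def)
  have "(\<Sum>\<^sub>\<infinity>i. (norm (T [sharp s i]))\<^sup>2) = infsum ?f (range (\<lambda>i. [(s, i)]))"
    by (subst infsum_reindex[OF inj]) (simp add: o_def)
  also have "\<dots> \<le> infsum ?f {ix. length ix = 1}"
    by (rule infsum_mono_neutral[OF s' s]) (use sub in auto)
  finally show "sqrt (\<Sum>\<^sub>\<infinity>i. (norm (T [sharp s i]))\<^sup>2) \<le> hs_norm 1 T"
    unfolding hs_norm_def by (rule real_sqrt_le_mono)
qed

text \<open>On first derivatives of \<open>F\<close> and \<open>G\<close>, the flag
  \<open>False\<close> gives the contraction \<open>\<langle>D\<^sub>1F, D\<^sub>2G\<rangle>\<close>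
  written in the basis, and \<open>True\<close> gives
  \<open>\<langle>D\<^sub>1G, D\<^sub>2F\<rangle>\<close>.\<close>

definition trace_form ::
    "bool \<Rightarrow> (('h \<times> 'd) list \<Rightarrow> 'k) \<Rightarrow> (('h \<times> 'd) list \<Rightarrow> 'k) \<Rightarrow> 'k"
  where "trace_form s S T = (\<Sum>\<^sub>\<infinity>i. S [sharp s i] * T [sharp (\<not> s) i])"

lemma trace_form_norm_le:
  assumes S: "S \<in> hs_forms 1" and T: "T \<in> hs_forms 1"
  shows "norm (trace_form s S T) \<le> hs_norm 1 S * hs_norm 1 T"
proof -
  have "norm (trace_form s S T) \<le> sqrt (\<Sum>\<^sub>\<infinity>i. (norm (S [sharp s i]))\<^sup>2) *
      sqrt (\<Sum>\<^sub>\<infinity>i. (norm (T [sharp (\<not> s) i]))\<^sup>2)"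
    unfolding trace_form_def
    by (rule infsum_Cauchy_Schwarz(2)[OF hs_form_sharp_summable(1)[OF S] hs_form_sharp_summable(1)[OF T]])
  also have "\<dots> \<le> hs_norm 1 S * hs_norm 1 T"
    by (intro mult_mono hs_form_sharp_summable S T real_sqrt_ge_zero infsum_nonneg)
      (simp_all add: hs_norm_def infsum_nonneg)
  finally show ?thesis .
qed

lemma trace_form_summable:
  assumes "S \<in> hs_forms 1" "T \<in> hs_forms 1"
  shows "(\<lambda>i. S [sharp s i] * T [sharp t i]) summable_on UNIV"
  by (rule abs_summable_summable, rule infsum_Cauchy_Schwarz(1))
    (rule hs_form_sharp_summable(1), rule assms)+

lemma trace_form_add:
  assumes R: "R \<in> hs_forms 1" and S: "S \<in> hs_forms 1" and T: "T \<in> hs_forms 1"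
  shows "trace_form s (\<lambda>vs. R vs + S vs) T = trace_form s R T + trace_form s S T"
    and "trace_form s T (\<lambda>vs. R vs + S vs) = trace_form s T R + trace_form s T S"
  unfolding trace_form_def distrib_left distrib_right
  by (rule infsum_add[OF trace_form_summable[OF R T] trace_form_summable[OF S T]],
      rule infsum_add[OF trace_form_summable[OF T R] trace_form_summable[OF T S]])

lemma trace_form_scale:
  "trace_form s (\<lambda>vs. c * S vs) T = c * trace_form s S T"
  "trace_form s T (\<lambda>vs. c * S vs) = c * trace_form s T S"
  unfolding trace_form_def by (simp_all add: infsum_cmult_right' mult.assoc mult.left_commute)

lemma bounded_bilinear_form_trace:
  "bounded_bilinear_form 1 (\<lambda>S T. \<alpha> * trace_form False S T + \<beta> * trace_form True S T)"
    (is "bounded_bilinear_form 1 ?B")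
proof -
  have bd: "norm (?B S T) \<le> (norm \<alpha> + norm \<beta>) * hs_norm 1 S * hs_norm 1 T"
    if "S \<in> hs_forms 1" "T \<in> hs_forms 1" for S T
  proof -
    have "norm (?B S T) \<le> norm \<alpha> * (hs_norm 1 S * hs_norm 1 T) + norm \<beta> * (hs_norm 1 S * hs_norm 1 T)"
      using trace_form_norm_le[OF that]
      by (intro norm_triangle_le add_mono) (auto simp: norm_mult intro!: mult_left_mono)
    then show ?thesis by (simp add: algebra_simps)
  qed
  have "bounded_form 1 (?B S)" if "S \<in> hs_forms 1" for S
    unfolding bounded_form_def
    using bd[OF that] that
    by (auto simp: trace_form_add trace_form_scale algebra_simps
        intro!: exI[of _ "(norm \<alpha> + norm \<beta>) * hs_norm 1 S"])
  moreover have "bounded_form 1 (\<lambda>S. ?B S T)" if "T \<in> hs_forms 1" for T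
    unfolding bounded_form_def
    using bd[OF _ that] that
    by (auto simp: trace_form_add trace_form_scale algebra_simps
        intro!: exI[of _ "(norm \<alpha> + norm \<beta>) * hs_norm 1 T"])
  ultimately show ?thesis
    unfolding bounded_bilinear_form_def using bd by blast
qed

lemma pr_zero_left [simp]: "pr 0 x = 0"
  using pr_scale[of 0 0 x] by simp

lemma pr_zero_right [simp]: "pr \<xi> 0 = 0"
  using linear_0 bounded_linear.linear[OF pr_bounded] by blast

lemma covector_sharp:
  "covector u (sharp False i) = pr (fst u) (e i)"
  "covector u (sharp True i) = pr (dual_basis i) (snd u)"
  by (simp_all add: covector_def sharp_def)

lemma trace_form_elem_tensor:
  "trace_form False (elem_tensor [u]) (elem_tensor [v]) = pr (fst u) (snd v)"
  "trace_form True (elem_tensor [u]) (elem_tensor [v]) = pr (fst v) (snd u)"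
  unfolding trace_form_def elem_tensor_def
  by (auto simp: covector_sharp infsumI[OF pr_expansion] mult.commute[of "pr (dual_basis _) _"])

text \<open>\<open>b_tensor\<close> is chosen by \<open>SOME\<close>, so its value is accessible
  only once some form with the required properties is known. For \<open>b_form A\<close> of the
  given shape, the same combination of the two trace forms is such a form.\<close>

lemma b_tensor_elem_tensor:
  assumes "\<And>u v. b_form A u v = \<alpha> * pr (fst u) (snd v) + \<beta> * pr (fst v) (snd u)"
  shows "b_tensor A 1 (elem_tensor [u]) (elem_tensor [v]) = b_form A u v"
proof -
  let ?P = "\<lambda>B. bounded_bilinear_form 1 B \<and>
    (\<forall>us vs. length us = 1 \<longrightarrow> length vs = 1 \<longrightarrow>
      B (elem_tensor us) (elem_tensor vs) = prod_list (map2 (b_form A) us vs))"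
  have "?P (\<lambda>S T. \<alpha> * trace_form False S T + \<beta> * trace_form True S T)"
    using bounded_bilinear_form_trace
    by (auto simp: length_Suc_conv assms trace_form_elem_tensor)
  then have "?P (b_tensor A 1)" unfolding b_tensor_def by (rule someI[where P = ?P])
  then show ?thesis by simp
qed

lemma b_tensor_zero: "b_tensor (\<lambda>x. 0) 1 (elem_tensor [u]) (elem_tensor [v]) =
    pr (fst u) (snd v) - pr (fst v) (snd u)"
proof -
  have neg: "pr \<xi> (- y) = - pr \<xi> y" for \<xi> y
    using linear_neg bounded_linear.linear[OF pr_bounded] by blast
  show ?thesis
    by (subst b_tensor_elem_tensor[of _ 1 "-1"]) (auto simp: b_form_def neg split: prod.splits)
qed

lemma b_tensor_id: "b_tensor (\<lambda>x. x) 1 (elem_tensor [u]) (elem_tensor [v]) =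
    2 * pr (fst u) (snd v)"
proof -
  have add: "pr \<xi> (y + y) = 2 * pr \<xi> y" for \<xi> y
    using linear_add[OF bounded_linear.linear[OF pr_bounded], of \<xi> y y] by simp
  show ?thesis
    by (subst b_tensor_elem_tensor[of _ 2 0]) (auto simp: b_form_def add split: prod.splits)
qed

section \<open>Quadratic functions: derivatives, smoothness, Hilbert-Schmidt type\<close>

text \<open>One computation serves all test functions: a coordinate is the case
  \<open>L1 = L2 = 0\<close>, a product of two coordinates the case \<open>L0 = 0\<close>.\<close>

lemma nderiv_quadratic:
  fixes L0 L1 L2 :: "'v::real_normed_vector \<Rightarrow> 'b::real_normed_field"
  assumes L: "bounded_linear L0" "bounded_linear L1" "bounded_linear L2"
  defines "F \<equiv> \<lambda>w. L0 w + L1 w * L2 w"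
  shows "nderiv F [v] = (\<lambda>w. L0 v + L1 w * L2 v + L1 v * L2 w)"
    and "nderiv F [u, v] = (\<lambda>w. L1 u * L2 v + L1 v * L2 u)"
    and "length vs \<ge> 3 \<Longrightarrow> nderiv F vs = (\<lambda>w. 0)"
proof -
  note L' [derivative_intros] = L[THEN bounded_linear_imp_has_derivative]
  note [derivative_intros] = has_derivative_mult[OF L'(2,3)]
  have "(F has_derivative (\<lambda>v. L0 v + (L1 w * L2 v + L1 v * L2 w))) (at w)" for w
    unfolding F_def by (intro derivative_intros)
  from frechet_derivative_at[OF this]
  show 1: "nderiv F [v] = (\<lambda>w. L0 v + L1 w * L2 v + L1 v * L2 w)" for v
    by (simp add: fun_eq_iff add.assoc)
  have "((\<lambda>w. L0 v + L1 w * L2 v + L1 v * L2 w) has_derivative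
      (\<lambda>u. L1 u * L2 v + L1 v * L2 u)) (at w)" for v w
    by (auto intro!: derivative_eq_intros)
  from frechet_derivative_at[OF this]
  show 2: "nderiv F [u, v] = (\<lambda>w. L1 u * L2 v + L1 v * L2 u)" for u v
    unfolding nderiv.simps(2)[of _ u] 1 by (simp add: fun_eq_iff)
  show "nderiv F vs = (\<lambda>w. 0)" if "length vs \<ge> 3" for vs
    using that
  proof (induction vs)
    case (Cons t vs)
    show ?case
    proof (cases "length vs \<ge> 3")
      case True
      with Cons.IH show ?thesis by simp
    next
      case False
      with Cons.prems have "length vs = Suc (Suc 0)" by simp
      then obtain u v where "vs = [u, v]" by (auto simp: length_Suc_conv)
      then show ?thesis by (simp only: nderiv.simps(2)[of _ t] 2 frechet_derivative_const)
    qed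
  qed simp
qed

lemma smooth_fun_quadratic:
  assumes L: "bounded_linear L0" "bounded_linear L1" "bounded_linear L2"
    and scale: "\<And>c w. L0 (scW c w) = c * L0 w" "\<And>c w. L1 (scW c w) = c * L1 w"
      "\<And>c w. L2 (scW c w) = c * L2 w"
  shows "smooth_fun (\<lambda>w. L0 w + L1 w * L2 w)" (is "smooth_fun ?F")
proof -
  interpret L0: bounded_linear L0 by fact
  interpret L1: bounded_linear L1 by fact
  interpret L2: bounded_linear L2 by fact
  note nd = nderiv_quadratic[OF L]
  obtain K0 K1 K2 where K: "K0 > 0" "K1 > 0" "K2 > 0"
    and K0: "\<And>w. norm (L0 w) \<le> norm w * K0" and K1: "\<And>w. norm (L1 w) \<le> norm w * K1"
    and K2: "\<And>w. norm (L2 w) \<le> norm w * K2"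
    using L0.pos_bounded L1.pos_bounded L2.pos_bounded by blast
  have ml: "multilin m (\<lambda>vs. nderiv ?F vs w)" for m w
    unfolding multilin_def
  proof (intro allI impI conjI)
    fix us vs :: "('h \<times> 'd) list" and u v c
    \<comment> \<open>The slot being varied is the only one, the first or the second of two, or one
      of at least three.\<close>
    consider "us = []" "vs = []" | t where "us = []" "vs = [t]" | t where "us = [t]" "vs = []"
      | "length us + length vs + 1 \<ge> 3"
      by (cases us rule: list_length_cases; cases vs rule: list_length_cases) auto
    note cs = this
    show "nderiv ?F (us @ (u + v) # vs) w = nderiv ?F (us @ u # vs) w + nderiv ?F (us @ v # vs) w"
      by (rule cs) (simp_all only: append.simps nd nd(3)[of "_ @ _"],
          simp_all add: L0.add L1.add L2.add algebra_simps nd(3))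
    show "nderiv ?F (us @ scW c u # vs) w = c * nderiv ?F (us @ u # vs) w"
      by (rule cs) (simp_all only: append.simps nd nd(3)[of "_ @ _"],
          simp_all add: scale algebra_simps nd(3))
  qed
  have bound: "\<exists>C. \<forall>vs. length vs = m \<longrightarrow> norm (nderiv ?F vs w) \<le> C * prod_list (map norm vs)"
    for m w
  proof -
    consider "m = 0" | "m = 1" | "m = 2" | "m \<ge> 3" by linarith
    then show ?thesis
    proof cases
      case 1
      then show ?thesis by (intro exI[of _ "norm (?F w)"]) simp
    next
      case 2
      have "norm (nderiv ?F [v] w) \<le> (K0 + norm (L1 w) * K2 + K1 * norm (L2 w)) * norm v" for v
      proof -
        have "norm (nderiv ?F [v] w) \<le> norm v * K0 + norm (L1 w) * (norm v * K2)
            + (norm v * K1) * norm (L2 w)"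
          unfolding nd(1)
          by (intro norm_triangle_le add_mono)
            (auto simp: norm_mult intro: mult_left_mono mult_right_mono K0 K1 K2)
        then show ?thesis by (simp add: algebra_simps)
      qed
      with 2 show ?thesis
        by (intro exI[of _ "K0 + norm (L1 w) * K2 + K1 * norm (L2 w)"])
          (auto simp: length_Suc_conv simp del: nderiv.simps)
    next
      case 3
      have "norm (nderiv ?F [u, v] w) \<le> 2 * K1 * K2 * (norm u * norm v)" for u v
      proof -
        have "norm (nderiv ?F [u, v] w)
            \<le> (norm u * K1) * (norm v * K2) + (norm v * K1) * (norm u * K2)"
          unfolding nd(2)
          by (intro norm_triangle_le add_mono)
            (use K in \<open>auto simp: norm_mult intro!: mult_mono K1 K2\<close>)
        then show ?thesis by (simp add: algebra_simps)
      qed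
      with 3 show ?thesis
        by (intro exI[of _ "2 * K1 * K2"])
          (auto simp: length_Suc_conv numeral_2_eq_2 simp del: nderiv.simps)
    next
      case 4
      then show ?thesis by (intro exI[of _ 0]) (simp add: nd(3))
    qed
  qed
  \<comment> \<open>Only order 0 leaves a remainder, namely \<open>L1 h * L2 h\<close>, of size at
    most \<open>K1 * K2 * (norm h)\<^sup>2\<close>; hence the radius
    \<open>\<epsilon> / (K1 * K2)\<close>. The first derivative is affine in the base point and the
    second is constant.\<close>
  have diff: "norm (nderiv ?F vs (w + h) - nderiv ?F vs w - nderiv ?F (h # vs) w)
      \<le> \<epsilon> * norm h * prod_list (map norm vs)"
    if "\<epsilon> > 0" and h: "norm h < \<epsilon> / (K1 * K2)" for vs w h and \<epsilon> :: real
  proof -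
    show ?thesis
    proof (cases vs rule: list_length_cases)
      case 1
      have "nderiv ?F [] (w + h) - nderiv ?F [] w - nderiv ?F [h] w = L1 h * L2 h"
        unfolding nd(1) by (simp add: L0.add L1.add L2.add algebra_simps)
      moreover have "norm (L1 h * L2 h) \<le> (norm h * K1) * (norm h * K2)"
        unfolding norm_mult by (intro mult_mono K1 K2) (use K in auto)
      moreover have "(norm h * K1) * (norm h * K2) \<le> \<epsilon> * norm h"
        using h K mult_right_mono[of "norm h * (K1 * K2)" \<epsilon> "norm h"]
        by (simp add: field_simps)
      ultimately show ?thesis using 1 by simp
    next
      case (2 v)
      have "nderiv ?F [v] (w + h) - nderiv ?F [v] w - nderiv ?F [h, v] w = 0"
        unfolding nd by (simp add: L1.add L2.add algebra_simps)
      with 2 that(1) show ?thesis by simp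
    next
      case (3 u v)
      have "nderiv ?F [u, v] (w + h) - nderiv ?F [u, v] w - nderiv ?F [h, u, v] w = 0"
        unfolding nd(2) by (simp add: nd(3) del: nderiv.simps)
      with 3 that(1) show ?thesis by simp
    next
      case 4
      have "nderiv ?F vs (w + h) - nderiv ?F vs w - nderiv ?F (h # vs) w = 0"
        using 4 by (simp add: nd(3) del: nderiv.simps)
      with that(1) show ?thesis
        by (auto simp del: nderiv.simps intro!: mult_nonneg_nonneg prod_list_nonneg)
    qed
  qed
  show ?thesis
    unfolding smooth_fun_def smooth_into_def
  proof (intro allI conjI impI ballI)
    fix \<epsilon> :: real assume "\<epsilon> > 0"
    with K diff show "\<exists>\<delta>>0. \<forall>h. norm h < \<delta> \<longrightarrow> (\<forall>vs. length vs = m \<longrightarrow> (\<forall>t\<in>(UNIV :: unit set).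
      norm (nderiv ?F vs (w + h) - nderiv ?F vs w - nderiv ?F (h # vs) w)
        \<le> \<epsilon> * norm h * prod_list (map norm vs) * 1))" for m w
      by (intro exI[of _ "\<epsilon> / (K1 * K2)"]) simp
  qed (use ml bound in auto)
qed

text \<open>If the linear parts see only the basis directions with index in the finite set
  \<open>J\<close>, an iterated derivative vanishes unless all its indices lie in \<open>J\<close>,
  so each sum has finitely many nonzero terms.\<close>

lemma quadratic_in_F_HS:
  assumes L: "bounded_linear L0" "bounded_linear L1" "bounded_linear L2"
    and scale: "\<And>c w. L0 (scW c w) = c * L0 w" "\<And>c w. L1 (scW c w) = c * L1 w"
      "\<And>c w. L2 (scW c w) = c * L2 w"
    and J: "finite J" "\<And>s i. i \<notin> J \<Longrightarrow> L0 (sharp s i) = 0"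
      "\<And>s i. i \<notin> J \<Longrightarrow> L1 (sharp s i) = 0" "\<And>s i. i \<notin> J \<Longrightarrow> L2 (sharp s i) = 0"
  shows "(\<lambda>w. L0 w + L1 w * L2 w) \<in> F_HS" (is "?F \<in> _")
proof -
  note nd = nderiv_quadratic[OF L]
  have "(\<lambda>is. (norm (nderiv ?F (map2 sharp ss is) w))\<^sup>2) summable_on {is. length is = r}"
    if "r \<ge> 1" "length ss = r" for r w ss
  proof -
    let ?X = "{is. set is \<subseteq> J \<and> length is = r}"
    have z: "nderiv ?F (map2 sharp ss is) w = 0" if "length is = r" "\<not> set is \<subseteq> J" for "is"
    proof -
      consider "r = 1" | "r = 2" | "r \<ge> 3" using \<open>r \<ge> 1\<close> by linarith
      then show ?thesis
      proof cases
        case 1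
        with that \<open>length ss = r\<close> obtain s i where "ss = [s]" "is = [i]"
          by (auto simp: length_Suc_conv)
        with that(2) show ?thesis by (simp add: nd J del: nderiv.simps)
      next
        case 2
        with that \<open>length ss = r\<close> obtain s t i j
          where "ss = [s, t]" "is = [i, j]"
          by (auto simp: length_Suc_conv numeral_2_eq_2)
        with that(2) show ?thesis by (auto simp: nd J simp del: nderiv.simps)
      next
        case 3
        with that \<open>length ss = r\<close> show ?thesis by (simp add: nd)
      qed
    qed
    have "(\<lambda>is. (norm (nderiv ?F (map2 sharp ss is) w))\<^sup>2) summable_on ?X"
      by (rule summable_on_finite[OF finite_lists_length_eq[OF J(1)]])
    then show ?thesis
      by (rule summable_on_cong_neutral[THEN iffD1, rotated -1]) (use z in force)+
  qed
  then show ?thesis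
    unfolding F_HS_def using smooth_fun_quadratic[OF L scale] by blast
qed

section \<open>The coordinate functions \<open>x\<^sub>i\<close>, \<open>\<eta>\<^sub>i\<close> and
  their products\<close>

definition pos :: "nat \<Rightarrow> 'h \<times> 'd \<Rightarrow> 'k"
  where "pos i w = pr (dual_basis i) (fst w)"

definition mom :: "nat \<Rightarrow> 'h \<times> 'd \<Rightarrow> 'k"
  where "mom i w = pr (snd w) (e i)"

lemma bounded_linear_pr_left: "bounded_linear (\<lambda>\<xi>. pr \<xi> x)"
proof (rule bounded_linear_intro)
  show "pr (r *\<^sub>R \<xi>) x = r *\<^sub>R pr \<xi> x" for r \<xi>
    by (simp add: pr_scale scaleR_conv_of_real flip: sd_of_real)
  show "norm (pr \<xi> x) \<le> norm \<xi> * norm x" for \<xi>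
    using onorm[OF pr_bounded] by (simp add: norm_dual)
qed (rule pr_add)

lemma bounded_linear_pos: "bounded_linear (pos i)"
  unfolding pos_def[abs_def] by (rule bounded_linear_compose[OF pr_bounded bounded_linear_fst])

lemma bounded_linear_mom: "bounded_linear (mom i)"
  unfolding mom_def[abs_def]
  by (rule bounded_linear_compose[OF bounded_linear_pr_left bounded_linear_snd])

lemma pos_scW: "pos i (scW c w) = c * pos i w"
  by (simp add: pos_def scW_def pr_linear)

lemma mom_scW: "mom i (scW c w) = c * mom i w"
  by (simp add: mom_def scW_def pr_scale)

lemma pos_sharp: "pos i (sharp s j) = of_bool (\<not> s \<and> i = j)"
  by (auto simp: pos_def sharp_def pr_dual_basis e_orthonormal)

lemma mom_sharp: "mom i (sharp s j) = of_bool (s \<and> i = j)"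
  by (auto simp: mom_def sharp_def pr_dual_basis e_orthonormal)

lemmas pos_mom = bounded_linear_pos bounded_linear_mom pos_scW mom_scW

lemma pos_in_F_HS: "pos i \<in> F_HS"
  using quadratic_in_F_HS[of "pos i" "\<lambda>_. 0" "\<lambda>_. 0" "{i}"]
  by (simp add: pos_mom pos_sharp bounded_linear_zero)

lemma mom_in_F_HS: "mom i \<in> F_HS"
  using quadratic_in_F_HS[of "mom i" "\<lambda>_. 0" "\<lambda>_. 0" "{i}"]
  by (simp add: pos_mom mom_sharp bounded_linear_zero)

lemma pos_mom_in_F_HS: "(\<lambda>w. pos i w * mom i w) \<in> F_HS"
  using quadratic_in_F_HS[of "\<lambda>_. 0" "pos i" "mom i" "{i}"]
  by (simp add: pos_mom pos_sharp mom_sharp bounded_linear_zero)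

text \<open>A bounded linear function is its own derivative; this puts the first derivatives of the
  coordinates among the elementary tensors, on which \<open>b_tensor\<close> is known.\<close>

lemma D_1_linear:
  assumes "bounded_linear L" and "\<And>v. L v = covector u v"
  shows "D 1 L w = elem_tensor [u]"
proof -
  have "nderiv L [v] w = covector u v" for v
    using frechet_derivative_at[OF bounded_linear_imp_has_derivative[OF assms(1)], of w] assms(2)
    by simp
  then show ?thesis
    by (auto simp: D_def elem_tensor_def length_Suc_conv fun_eq_iff simp del: nderiv.simps)
qed

lemma D_1_pos: "D 1 (pos i) w = elem_tensor [(dual_basis i, 0)]"
  by (rule D_1_linear[OF bounded_linear_pos]) (simp add: pos_def covector_def)

lemma D_1_mom: "D 1 (mom i) w = elem_tensor [(0, e i)]"
  by (rule D_1_linear[OF bounded_linear_mom]) (simp add: mom_def covector_def)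

text \<open>Orders 0 and 1 vanish at the origin because both coordinates do, orders from 3 on vanish
  everywhere. Evaluation at 0 thus isolates the second order coefficient of an operator.\<close>

lemma D_pos_mom:
  "D 2 (\<lambda>w. pos i w * mom i w) w [u, v] = pos i u * mom i v + pos i v * mom i u"
  "n \<noteq> 2 \<Longrightarrow> D n (\<lambda>w. pos i w * mom i w) 0 = (\<lambda>_. 0)"
proof -
  note nd = nderiv_quadratic[OF bounded_linear_zero bounded_linear_pos[of i] bounded_linear_mom[of i],
      unfolded add_0]
  show "D 2 (\<lambda>w. pos i w * mom i w) w [u, v] = pos i u * mom i v + pos i v * mom i u"
    unfolding D_def using nd(2)[of u v] by simp
  have z: "pos i 0 = 0" "mom i 0 = 0" by (simp_all add: pos_def mom_def)
  have "nderiv (\<lambda>w. pos i w * mom i w) vs 0 = 0" if "length vs \<noteq> 2" for vs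
    by (cases vs rule: list_length_cases) (use z nd(1,3) that in \<open>auto simp del: nderiv.simps(2)\<close>)
  then show "D n (\<lambda>w. pos i w * mom i w) 0 = (\<lambda>_. 0)" if "n \<noteq> 2"
    using that by (auto simp: D_def fun_eq_iff)
qed

section \<open>The second order tensors of \<open>x\<^sub>i \<eta>\<^sub>i\<close> and their
  Hilbert-Schmidt norm\<close>

lemma bounded_multilin_D:
  assumes "F \<in> F_HS"
  shows "bounded_multilin m (D m F w)"
proof -
  have "smooth_into (UNIV :: unit set) (\<lambda>_. 1) (\<lambda>w _. F w)"
    using assms by (simp add: F_HS_def smooth_fun_def)
  then have "(\<forall>t\<in>(UNIV :: unit set). multilin m (\<lambda>vs. nderiv F vs w)) \<and>
    (\<exists>C. \<forall>vs. length vs = m \<longrightarrow> (\<forall>t\<in>(UNIV :: unit set).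
      norm (nderiv F vs w) \<le> C * prod_list (map norm vs) * 1))"
    unfolding smooth_into_def by blast
  then show ?thesis
    unfolding bounded_multilin_def multilin_def D_def by simp
qed

lemma bounded_multilin_add:
  assumes "bounded_multilin m S" "bounded_multilin m T"
  shows "bounded_multilin m (\<lambda>vs. S vs + T vs)"
proof -
  obtain B C where "\<And>vs. length vs = m \<Longrightarrow> norm (S vs) \<le> B * prod_list (map norm vs)"
      "\<And>vs. length vs = m \<Longrightarrow> norm (T vs) \<le> C * prod_list (map norm vs)"
    using assms unfolding bounded_multilin_def by blast
  then have "norm (S vs + T vs) \<le> (B + C) * prod_list (map norm vs)" if "length vs = m" for vs
    using that unfolding distrib_right by (intro norm_triangle_le add_mono) auto
  moreover have "multilin m (\<lambda>vs. S vs + T vs)"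
    using assms unfolding bounded_multilin_def multilin_def by (auto simp: algebra_simps)
  ultimately show ?thesis unfolding bounded_multilin_def by blast
qed

text \<open>The symmetrized canonical pairing cut off to the coordinates in \<open>I\<close>. Stated
  through \<open>D\<close>, it vanishes on lists of the wrong length, and its singleton case is
  exactly what an operator coefficient is applied to.\<close>

definition pairing_form :: "nat set \<Rightarrow> ('h \<times> 'd) list \<Rightarrow> 'k"
  where "pairing_form I vs = (\<Sum>i\<in>I. D 2 (\<lambda>w. pos i w * mom i w) 0 vs)"

lemma bounded_multilin_pairing_form: "bounded_multilin 2 (pairing_form I)"
proof (induction I rule: infinite_finite_induct)
  case (insert i I)
  from bounded_multilin_add[OF bounded_multilin_D[OF pos_mom_in_F_HS] insert(3)]
  show ?case using insert(1,2) by (simp add: pairing_form_def[abs_def])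
qed (use zero_in_hs_forms[of 2] in \<open>simp_all add: hs_forms_def pairing_form_def[abs_def]\<close>)

lemma pairing_form_sharp:
  assumes "finite I"
  shows "pairing_form I [sharp s i, sharp t j] = of_bool (s \<noteq> t \<and> i = j \<and> i \<in> I)"
proof -
  have "pairing_form I [sharp s i, sharp t j] =
      (\<Sum>k\<in>I. if k = i then of_bool (s \<noteq> t \<and> i = j) else 0)"
    unfolding pairing_form_def D_pos_mom
    by (intro sum.cong) (auto simp: pos_sharp mom_sharp)
  with assms show ?thesis by auto
qed

text \<open>In the basis the tensor has entries 0 and 1, and each index in \<open>I\<close> accounts
  for two entries 1: position before momentum and momentum before position.\<close>

lemma pairing_form_has_sum:
  assumes "finite I"
  shows "((\<lambda>ix. (norm (pairing_form I (map (\<lambda>(s, i). sharp s i) ix)))\<^sup>2) has_sum real (2 * card I))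
    {ix. length ix = 2}"
proof -
  \<comment> \<open>\<open>?X\<close> collects the index lists at which the entry is 1.\<close>
  let ?h = "\<lambda>(s, i). [(s, i), (\<not> s, i)]" and ?f = "\<lambda>ix. pairing_form I (map (\<lambda>(s, i). sharp s i) ix)"
  let ?X = "?h ` (UNIV \<times> I)"
  have v: "?f ix = of_bool (ix \<in> ?X)" if "length ix = 2" for ix
  proof -
    from that obtain s i t j where "ix = [(s, i), (t, j)]"
      by (auto simp: length_Suc_conv numeral_2_eq_2)
    then show ?thesis by (auto simp: pairing_form_sharp[OF assms] image_iff)
  qed
  have "inj_on ?h (UNIV \<times> I)" by (auto simp: inj_on_def)
  then have "card ?X = 2 * card I" by (simp add: card_image card_cartesian_product)
  moreover have "finite ?X" using assms by simp
  ultimately have "((\<lambda>ix. 1 :: real) has_sum real (2 * card I)) ?X"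
    using has_sum_finite[of ?X "\<lambda>_. 1 :: real"] by simp
  then show ?thesis
    by (rule has_sum_cong_neutral[THEN iffD1, rotated -1]) (auto simp: v)
qed

lemma pairing_form_in_hs_forms:
  assumes "finite I"
  shows "pairing_form I \<in> hs_forms 2"
  using bounded_multilin_pairing_form has_sum_imp_summable[OF pairing_form_has_sum[OF assms]]
  by (auto simp: hs_forms_def pairing_form_def D_def)

lemma hs_norm_pairing_form: "finite I \<Longrightarrow> hs_norm 2 (pairing_form I) = sqrt (2 * card I)"
  unfolding hs_norm_def using infsumI[OF pairing_form_has_sum] by simp

lemma pairing_form_singleton: "pairing_form {i} = D 2 (\<lambda>w. pos i w * mom i w) 0"
  by (simp add: pairing_form_def[abs_def])

lemma bounded_form_pairing_form:
  assumes \<phi>: "bounded_form 2 \<phi>" and "finite I"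
  shows "\<phi> (pairing_form I) = (\<Sum>i\<in>I. \<phi> (pairing_form {i}))"
  using \<open>finite I\<close>
proof (induction I)
  case empty
  then show ?case using bounded_form_zero[OF \<phi>] by (simp add: pairing_form_def[abs_def])
next
  case (insert i I)
  then have "pairing_form (insert i I) = (\<lambda>vs. pairing_form {i} vs + pairing_form I vs)"
    by (simp add: pairing_form_def[abs_def])
  moreover have "\<phi> (\<lambda>vs. pairing_form {i} vs + pairing_form I vs) =
      \<phi> (pairing_form {i}) + \<phi> (pairing_form I)"
    using \<phi> pairing_form_in_hs_forms[of "{i}"] pairing_form_in_hs_forms[OF insert(1)]
    unfolding bounded_form_def by blast
  ultimately show ?case using insert by simp
qed

lemma bounded_form_not_trace:
  assumes \<phi>: "bounded_form 2 \<phi>"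
  shows "\<exists>i. \<phi> (pairing_form {i}) \<noteq> - 1"
proof (rule ccontr)
  assume "\<not> ?thesis"
  then have v: "\<phi> (pairing_form {..<N}) = - of_nat N" for N
    using bounded_form_pairing_form[OF \<phi>, of "{..<N}"] by simp
  obtain C where C: "\<And>T. T \<in> hs_forms 2 \<Longrightarrow> norm (\<phi> T) \<le> C * hs_norm 2 T"
    using \<phi> unfolding bounded_form_def by blast
  have le: "real N \<le> C * sqrt (2 * real N)" for N
    using C[OF pairing_form_in_hs_forms[of "{..<N}"]] by (simp add: v hs_norm_pairing_form)
  obtain N where N: "real N > 2 * C\<^sup>2" using reals_Archimedean2 by blast
  \<comment> \<open>Squaring only uses that the left side is nonnegative, so \<open>C\<close> may
    have any sign.\<close>
  have "(real N)\<^sup>2 \<le> (C * sqrt (2 * real N))\<^sup>2" by (rule power_mono[OF le]) simp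
  then have "real N * real N \<le> (2 * C\<^sup>2) * real N"
    by (simp add: power_mult_distrib power2_eq_square algebra_simps)
  moreover have "real N > 0" using N zero_le_power2[of C] by linarith
  ultimately show False using N by simp
qed

section \<open>The first order of an equivalence and the contradiction\<close>

text \<open>Compares the coefficients of \<hbar> on both sides, where \<open>P 1\<close> is the only
  operator to appear.\<close>

lemma equivalent_first_order:
  assumes "star A1 (formal_op P (embed F)) (formal_op P (embed G)) =
      formal_op P (star A2 (embed F) (embed G))"
  shows "C_op A1 1 F G w + F w * P 1 G w + P 1 F w * G w =
    C_op A2 1 F G w + P 1 (\<lambda>w. F w * G w) w"
  using arg_cong[where f = "\<lambda>s. fps_nth s (Suc 0) w", OF assms]
  by (simp add: star_def formal_op_def embed_def star_coeff_def algebra_simps)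

theorem Moyal_normal_not_equivalent: "\<not> equivalent (star (\<lambda>x. 0)) (star (\<lambda>x. x))"
proof
  assume "equivalent (star (\<lambda>x. 0)) (star (\<lambda>x. x))"
  then obtain P where P: "differential_operator (P 1)"
    and eq: "\<And>F G. F \<in> F_HS \<Longrightarrow> G \<in> F_HS \<Longrightarrow>
      star (\<lambda>x. 0) (formal_op P (embed F)) (formal_op P (embed G)) =
      formal_op P (star (\<lambda>x. x) (embed F) (embed G))"
    unfolding equivalent_def by (metis order_refl)
  have zero: "pos i 0 = 0" "mom i 0 = 0" for i by (simp_all add: pos_def mom_def)
  \<comment> \<open>At the origin both coordinates vanish, so the terms with \<open>P 1\<close> of a
    single coordinate drop out. The Moyal term is 1 and the normal term is 2, which leaves
    \<open>1 = 2 + P 1 (\<lambda>w. pos i w * mom i w) 0\<close>.\<close>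
  have val: "P 1 (\<lambda>w. pos i w * mom i w) 0 = - 1" for i
    using equivalent_first_order[OF eq[OF pos_in_F_HS mom_in_F_HS], of i i 0]
    by (simp add: zero C_op_def D_1_pos[simplified] D_1_mom[simplified]
        b_tensor_zero[simplified] b_tensor_id[simplified] pr_dual_basis e_orthonormal
        eq_neg_iff_add_eq_0 add.commute)
  obtain M a where a: "\<And>n w. n \<le> M \<Longrightarrow> bounded_form n (a n w)"
    and Pa: "\<And>F w. F \<in> F_HS \<Longrightarrow> P 1 F w = (\<Sum>n\<le>M. a n w (D n F w))"
    using P unfolding differential_operator_def by blast
  have "a n 0 (D n (\<lambda>w. pos i w * mom i w) 0) = (if n = 2 then a 2 0 (pairing_form {i}) else 0)"
    if "n \<le> M" for n i
    using bounded_form_zero[OF a[OF that]] by (simp add: D_pos_mom(2) pairing_form_singleton)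
  then have sum: "(if 2 \<le> M then a 2 0 (pairing_form {i}) else 0) = - 1" for i
    using val[of i] unfolding Pa[OF pos_mom_in_F_HS] by simp
  \<comment> \<open>An operator of order below 2 would give 0 instead of -1; so \<open>a 2 0\<close>
    does occur and is a bounded form.\<close>
  then have "2 \<le> M" by (metis neg_equal_0_iff_equal zero_neq_one)
  with sum bounded_form_not_trace[OF a, of 0] show False by auto
qed

end

theorem corollary1:
  fixes sc :: "'k::real_or_complex \<Rightarrow> 'h::banach \<Rightarrow> 'h"
    and ip :: "'h \<Rightarrow> 'h \<Rightarrow> 'k"
    and sd :: "'k \<Rightarrow> 'd::banach \<Rightarrow> 'd"
    and pr :: "'d \<Rightarrow> 'h \<Rightarrow> 'k"
    and e :: "nat \<Rightarrow> 'h"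
  assumes "phase_space sc ip sd pr e"
    and "separable_space (euclidean :: 'h topology)"
    and "\<not> (\<exists>B. finite B \<and> module.span sc B = UNIV)"
  shows "\<not> phase_space.equivalent sc sd pr e
    (phase_space.star sc sd pr e (\<lambda>x. 0)) (phase_space.star sc sd pr e (\<lambda>x. x))"
  by (rule phase_space.Moyal_normal_not_equivalent[OF assms(1)])

end
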